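(* Let $\mathbf{Z}_8$ be the ring of integers modulo $8$, regarded as the algebra $\langle \{0,1,\dots,7\}; +,\cdot,0\rangle$ (the multiplicative unit is not part of the signature). Then $\mathbf{Z}_8$ does not admit a natural duality; that is, there is no choice of $F$, $H$, $R$ (sets of operations, partial operations and relations algebraic over $\mathbf{Z}_8$) such that the discrete topological structure $\tilde{Z}_8=\langle \{0,1,\dots,7\};F,H,R,\tau\rangle$ yields a duality on $\mathbb{ISP}(\mathbf{Z}_8)$.
   Context: Natural dualities. Let $\mathbf{A}$ be a finite algebra with underlying set $A$. Consider topological structures $\tilde{A}=\langle A;F,H,R,\tau\rangle$ where: (a) each $f\in F$ is a homomorphism $f:\mathbf{A}^n\to\mathbf{A}$ for some $n\in\mathbb{N}\cup\{0\}$; (b) each $h\in H$ is a homomorphism $h:\mathrm{dom}(h)\to\mathbf{A}$, where $\mathrm{dom}(h)$ is a subalgebra of $\mathbf{A}^n$ for some $n\in\mathbb{N}$; (c) each $r\in R$ is the universe of a subalgebra of $\mathbf{A}^n$ for some $n\in\mathbb{N}$; (d) $\tau$ is the discrete topology. When (a), (b), (c) hold, the members of $F$, $H$, $R$ are said to be algebraic over $\mathbf{A}$. Let $\mathcal{A}=\mathbb{ISP}(\mathbf{A})$ be the quasivariety generated by $\mathbf{A}$ (isomorphic copies of subalgebras of direct powers of $\mathbf{A}$), and let $\mathcal{X}=\mathbb{IS}_c\mathbb{P}(\tilde{A})$ be the class of isomorphic copies of topologically closed substructures of direct powers of $\tilde{A}$, with product topology and pointwise structure. Morphisms in $\mathcal{X}$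 are the continuous maps preserving all operations in $F$, partial operations in $H$ (including their domains) and relations in $R$. For $\mathbf{B}\in\mathcal{A}$, let $D(\mathbf{B})=\mathcal{A}(\mathbf{B},\mathbf{A})$ be the set of all homomorphisms $\mathbf{B}\to\mathbf{A}$, viewed as a closed substructure of $\tilde{A}^{B}$. For $\tilde{X}\in\mathcal{X}$, let $E(\tilde{X})=\mathcal{X}(\tilde{X},\tilde{A})$ be the set of all morphisms $\tilde{X}\to\tilde{A}$, viewed as a subalgebra of $\mathbf{A}^{X}$. The natural embedding $e_{\mathbf{B}}:\mathbf{B}\to ED(\mathbf{B})$ is given by evaluation: $e_{\mathbf{B}}(b)(x)=x(b)$ for $b\in B$, $x\in D(\mathbf{B})$. The structure $\tilde{A}$ yields a (natural) duality on $\mathcal{A}$ if $e_{\mathbf{B}}$ is an isomorphism for every $\mathbf{B}\in\mathcal{A}$. The algebra $\mathbf{A}$ admits a natural duality (is dualizable) if there is some choice of $F,H,R$ satisfying (a), (b), (c) such that $\tilde{A}$ yields a duality on $\mathcal{A}$. Homomorphisms and subalgebras are taken with respect to the signature of $\mathbf{A}$. *)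

theory Defs
  imports "HOL-Analysis.Function_Topology"
begin

section \<open>Algebras\<close>

text \<open>
  Tuples of length \<open>n\<close> over \<open>X\<close> are the extensional functions in \<open>{..<n} \<rightarrow>\<^sub>E X\<close>, so that the
  \<open>n\<close>-th power is the special case \<open>I = {..<n}\<close> of the power over an index set \<open>I\<close>.
  Applying \<open>g\<close> to each entry of an \<open>n\<close>-tuple \<open>x\<close> is \<open>compose {..<n} g x\<close>.  The similarity
  type of an algebra is an arity function \<open>ar\<close> on the type of operation symbols.
\<close>

record ('f, 'a) algebra =
  carrier :: "'a set"
  interp :: "'f \<Rightarrow> (nat \<Rightarrow> 'a) \<Rightarrow> 'a"

definition subuniverse :: "('f \<Rightarrow> nat) \<Rightarrow> ('f, 'a) algebra \<Rightarrow> 'a set \<Rightarrow> bool" where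
  "subuniverse ar A S \<longleftrightarrow>
     S \<noteq> {} \<and> S \<subseteq> carrier A \<and> (\<forall>f. \<forall>x \<in> {..<ar f} \<rightarrow>\<^sub>E S. interp A f x \<in> S)"

definition is_algebra :: "('f \<Rightarrow> nat) \<Rightarrow> ('f, 'a) algebra \<Rightarrow> bool" where
  "is_algebra ar A \<longleftrightarrow> subuniverse ar A (carrier A)"

definition subalgebra :: "('f, 'a) algebra \<Rightarrow> 'a set \<Rightarrow> ('f, 'a) algebra" where
  "subalgebra A S = A\<lparr>carrier := S\<rparr>"

definition hom :: "('f \<Rightarrow> nat) \<Rightarrow> ('f, 'a) algebra \<Rightarrow> ('f, 'b) algebra \<Rightarrow> ('a \<Rightarrow> 'b) set" where
  "hom ar A B = {h \<in> carrier A \<rightarrow>\<^sub>E carrier B.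
     \<forall>f. \<forall>x \<in> {..<ar f} \<rightarrow>\<^sub>E carrier A. h (interp A f x) = interp B f (compose {..<ar f} h x)}"

definition iso :: "('f \<Rightarrow> nat) \<Rightarrow> ('f, 'a) algebra \<Rightarrow> ('f, 'b) algebra \<Rightarrow> ('a \<Rightarrow> 'b) set" where
  "iso ar A B = {h \<in> hom ar A B. bij_betw h (carrier A) (carrier B)}"

definition power_algebra ::
    "('f \<Rightarrow> nat) \<Rightarrow> ('f, 'a) algebra \<Rightarrow> 'i set \<Rightarrow> ('f, 'i \<Rightarrow> 'a) algebra" where
  "power_algebra ar A I =
     \<lparr>carrier = I \<rightarrow>\<^sub>E carrier A,
      interp = (\<lambda>f x. \<lambda>i\<in>I. interp A f (compose {..<ar f} (\<lambda>y. y i) x))\<rparr>"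

text \<open>
  The members of the quasivariety generated by \<open>A\<close> whose elements are of type \<open>'b\<close>.  Index sets
  of type \<open>('b \<Rightarrow> 'a) set\<close> are no restriction, see \<open>ISP_I\<close> below.
\<close>

definition ISP :: "('f \<Rightarrow> nat) \<Rightarrow> ('f, 'a) algebra \<Rightarrow> ('f, 'b) algebra set" where
  "ISP ar A = {B. is_algebra ar B \<and>
     (\<exists>(I :: ('b \<Rightarrow> 'a) set) S. subuniverse ar (power_algebra ar A I) S \<and>
        iso ar B (subalgebra (power_algebra ar A I) S) \<noteq> {})}"


section \<open>Structures of operations, partial operations and relations\<close>

text \<open>
  An operation is given by its arity and a function, a partial operation by its arity, its domain
  and a function, a relation by its arity and a set of tuples.
\<close>

type_synonym 'a operation = "nat \<times> ((nat \<Rightarrow> 'a) \<Rightarrow> 'a)"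
type_synonym 'a partial_operation = "nat \<times> (nat \<Rightarrow> 'a) set \<times> ((nat \<Rightarrow> 'a) \<Rightarrow> 'a)"
type_synonym 'a relation = "nat \<times> (nat \<Rightarrow> 'a) set"

definition algebraic_operations ::
    "('f \<Rightarrow> nat) \<Rightarrow> ('f, 'a) algebra \<Rightarrow> 'a operation set \<Rightarrow> bool" where
  "algebraic_operations ar A F \<longleftrightarrow>
     (\<forall>(n, f) \<in> F. f \<in> hom ar (power_algebra ar A {..<n}) A)"

definition algebraic_partial_operations ::
    "('f \<Rightarrow> nat) \<Rightarrow> ('f, 'a) algebra \<Rightarrow> 'a partial_operation set \<Rightarrow> bool" where
  "algebraic_partial_operations ar A H \<longleftrightarrow>
     (\<forall>(n, d, h) \<in> H. n \<ge> 1 \<and> subuniverse ar (power_algebra ar A {..<n}) d \<and>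
        h \<in> hom ar (subalgebra (power_algebra ar A {..<n}) d) A)"

definition algebraic_relations ::
    "('f \<Rightarrow> nat) \<Rightarrow> ('f, 'a) algebra \<Rightarrow> 'a relation set \<Rightarrow> bool" where
  "algebraic_relations ar A R \<longleftrightarrow>
     (\<forall>(n, r) \<in> R. n \<ge> 1 \<and> subuniverse ar (power_algebra ar A {..<n}) r)"

text \<open>
  The elements of \<open>F\<close>, \<open>H\<close>, \<open>R\<close> over \<open>A\<close> themselves serve as the symbols that are interpreted in
  a structure over another set of elements.  The underlying set of a structure is the
  \<open>topspace\<close> of its topology.
\<close>

record ('a, 'x) top_structure =
  topology_of :: "'x topology"
  operation_of :: "'a operation \<Rightarrow> (nat \<Rightarrow> 'x) \<Rightarrow> 'x"
  domain_of :: "'a partial_operation \<Rightarrow> (nat \<Rightarrow> 'x) set"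
  partial_operation_of :: "'a partial_operation \<Rightarrow> (nat \<Rightarrow> 'x) \<Rightarrow> 'x"
  relation_of :: "'a relation \<Rightarrow> (nat \<Rightarrow> 'x) set"

abbreviation points :: "('a, 'x) top_structure \<Rightarrow> 'x set" where
  "points X \<equiv> topspace (topology_of X)"

definition alter_ego :: "('f, 'a) algebra \<Rightarrow> ('a, 'a) top_structure" where
  "alter_ego A =
     \<lparr>topology_of = discrete_topology (carrier A),
      operation_of = (\<lambda>(n, f). f),
      domain_of = (\<lambda>(n, d, h). d),
      partial_operation_of = (\<lambda>(n, d, h). h),
      relation_of = (\<lambda>(n, r). r)\<rparr>"

definition power_structure ::
    "('a, 'x) top_structure \<Rightarrow> 'i set \<Rightarrow> ('a, 'i \<Rightarrow> 'x) top_structure" where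
  "power_structure X I =
     \<lparr>topology_of = product_topology (\<lambda>_. topology_of X) I,
      operation_of = (\<lambda>s x. \<lambda>i\<in>I. operation_of X s (compose {..<fst s} (\<lambda>y. y i) x)),
      domain_of = (\<lambda>s. {x \<in> {..<fst s} \<rightarrow>\<^sub>E (I \<rightarrow>\<^sub>E points X).
        \<forall>i\<in>I. compose {..<fst s} (\<lambda>y. y i) x \<in> domain_of X s}),
      partial_operation_of =
        (\<lambda>s x. \<lambda>i\<in>I. partial_operation_of X s (compose {..<fst s} (\<lambda>y. y i) x)),
      relation_of = (\<lambda>s. {x \<in> {..<fst s} \<rightarrow>\<^sub>E (I \<rightarrow>\<^sub>E points X).
        \<forall>i\<in>I. compose {..<fst s} (\<lambda>y. y i) x \<in> relation_of X s})\<rparr>"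

definition closed_substructure ::
    "'a operation set \<Rightarrow> 'a partial_operation set \<Rightarrow> ('a, 'x) top_structure \<Rightarrow> 'x set \<Rightarrow> bool" where
  "closed_substructure F H X S \<longleftrightarrow>
     closedin (topology_of X) S \<and>
     (\<forall>s\<in>F. \<forall>x \<in> {..<fst s} \<rightarrow>\<^sub>E S. operation_of X s x \<in> S) \<and>
     (\<forall>s\<in>H. \<forall>x \<in> domain_of X s \<inter> ({..<fst s} \<rightarrow>\<^sub>E S). partial_operation_of X s x \<in> S)"

definition substructure :: "('a, 'x) top_structure \<Rightarrow> 'x set \<Rightarrow> ('a, 'x) top_structure" where
  "substructure X S =
     X\<lparr>topology_of := subtopology (topology_of X) S,
       domain_of := (\<lambda>s. domain_of X s \<inter> ({..<fst s} \<rightarrow>\<^sub>E S)),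
       relation_of := (\<lambda>s. relation_of X s \<inter> ({..<fst s} \<rightarrow>\<^sub>E S))\<rparr>"

definition morphism_set ::
    "'a operation set \<Rightarrow> 'a partial_operation set \<Rightarrow> 'a relation set \<Rightarrow>
     ('a, 'x) top_structure \<Rightarrow> ('a, 'y) top_structure \<Rightarrow> ('x \<Rightarrow> 'y) set" where
  "morphism_set F H R X Y = {\<phi> \<in> points X \<rightarrow>\<^sub>E points Y.
     continuous_map (topology_of X) (topology_of Y) \<phi> \<and>
     (\<forall>s\<in>F. \<forall>x \<in> {..<fst s} \<rightarrow>\<^sub>E points X.
        \<phi> (operation_of X s x) = operation_of Y s (compose {..<fst s} \<phi> x)) \<and>
     (\<forall>s\<in>H. \<forall>x \<in> domain_of X s.
        compose {..<fst s} \<phi> x \<in> domain_of Y s \<and>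
        \<phi> (partial_operation_of X s x) = partial_operation_of Y s (compose {..<fst s} \<phi> x)) \<and>
     (\<forall>s\<in>R. \<forall>x \<in> relation_of X s. compose {..<fst s} \<phi> x \<in> relation_of Y s)}"


section \<open>Natural dualities\<close>

definition dual ::
    "('f \<Rightarrow> nat) \<Rightarrow> ('f, 'a) algebra \<Rightarrow> ('f, 'b) algebra \<Rightarrow> ('a, 'b \<Rightarrow> 'a) top_structure" where
  "dual ar A B = substructure (power_structure (alter_ego A) (carrier B)) (hom ar B A)"

definition dual_algebra ::
    "('f \<Rightarrow> nat) \<Rightarrow> ('f, 'a) algebra \<Rightarrow>
     'a operation set \<Rightarrow> 'a partial_operation set \<Rightarrow> 'a relation set \<Rightarrow>
     ('a, 'x) top_structure \<Rightarrow> ('f, 'x \<Rightarrow> 'a) algebra" where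
  "dual_algebra ar A F H R X =
     subalgebra (power_algebra ar A (points X)) (morphism_set F H R X (alter_ego A))"

definition evaluation ::
    "('f \<Rightarrow> nat) \<Rightarrow> ('f, 'a) algebra \<Rightarrow> ('f, 'b) algebra \<Rightarrow> 'b \<Rightarrow> ('b \<Rightarrow> 'a) \<Rightarrow> 'a" where
  "evaluation ar A B = (\<lambda>b \<in> carrier B. \<lambda>x \<in> hom ar B A. x b)"

text \<open>
  HOL cannot quantify over algebras of all sizes at once, so the type \<open>'b\<close> of the elements of the
  algebras in the quasivariety is a parameter.  For finite \<open>A\<close> with countably many operation
  symbols, every infinite \<open>'b\<close> gives the same notion: if the evaluation map of some member of the
  quasivariety fails to be an isomorphism, then by compactness so does that of a countable
  subalgebra.
\<close>

definition yields_duality ::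
    "'b itself \<Rightarrow> ('f \<Rightarrow> nat) \<Rightarrow> ('f, 'a) algebra \<Rightarrow>
     'a operation set \<Rightarrow> 'a partial_operation set \<Rightarrow> 'a relation set \<Rightarrow> bool" where
  "yields_duality (_ :: 'b itself) ar A F H R \<longleftrightarrow>
     (\<forall>B :: ('f, 'b) algebra. B \<in> ISP ar A \<longrightarrow>
        evaluation ar A B \<in> iso ar B (dual_algebra ar A F H R (dual ar A B)))"

definition dualizable :: "'b itself \<Rightarrow> ('f \<Rightarrow> nat) \<Rightarrow> ('f, 'a) algebra \<Rightarrow> bool" where
  "dualizable ty ar A \<longleftrightarrow>
     (\<exists>F H R. algebraic_operations ar A F \<and> algebraic_partial_operations ar A H \<and>
        algebraic_relations ar A R \<and> yields_duality ty ar A F H R)"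


section \<open>The ring of integers modulo 8\<close>

datatype ring_symbol = Plus | Times | Zero

primrec ring_arity :: "ring_symbol \<Rightarrow> nat" where
  "ring_arity Plus = 2"
| "ring_arity Times = 2"
| "ring_arity Zero = 0"

primrec Z8_interp :: "ring_symbol \<Rightarrow> (nat \<Rightarrow> nat) \<Rightarrow> nat" where
  "Z8_interp Plus x = (x 0 + x 1) mod 8"
| "Z8_interp Times x = (x 0 * x 1) mod 8"
| "Z8_interp Zero x = 0"

definition Z8 :: "(ring_symbol, nat) algebra" where
  "Z8 = \<lparr>carrier = {0..7}, interp = Z8_interp\<rparr>"


section \<open>Well-definedness of the notions\<close>

lemma is_algebra_Z8: "is_algebra ring_arity Z8"
proof -
  have m: "a mod 8 \<le> 7" for a :: nat by presburger
  have "Z8_interp f x \<in> {0..7}" for f x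
    by (cases f) (simp_all add: m)
  then show ?thesis by (simp add: is_algebra_def subuniverse_def Z8_def)
qed

lemma iso_coordinate:
  assumes B: "is_algebra ar B"
    and h: "h \<in> iso ar B (subalgebra (power_algebra ar A J) S)"
    and S: "subuniverse ar (power_algebra ar A J) S"
    and j: "j \<in> J"
  shows "(\<lambda>b \<in> carrier B. h b j) \<in> hom ar B A"
proof -
  have cl: "interp B f x \<in> carrier B" if "x \<in> {..<ar f} \<rightarrow>\<^sub>E carrier B" for f x
    using B that by (auto simp: is_algebra_def subuniverse_def)
  have hb: "h b \<in> J \<rightarrow>\<^sub>E carrier A" if "b \<in> carrier B" for b
    using h S that by (auto simp: iso_def hom_def subalgebra_def subuniverse_def power_algebra_def PiE_iff)
  have "h (interp B f x) j = interp A f (compose {..<ar f} (\<lambda>b \<in> carrier B. h b j) x)"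
    if x: "x \<in> {..<ar f} \<rightarrow>\<^sub>E carrier B" for f x
  proof -
    have "h (interp B f x) = interp (power_algebra ar A J) f (compose {..<ar f} h x)"
      using h x by (auto simp: iso_def hom_def subalgebra_def)
    moreover have "compose {..<ar f} (\<lambda>y. y j) (compose {..<ar f} h x)
        = compose {..<ar f} (\<lambda>b \<in> carrier B. h b j) x"
      using x by (auto simp: compose_def fun_eq_iff PiE_iff)
    ultimately show ?thesis using j by (simp add: power_algebra_def)
  qed
  moreover have "h b j \<in> carrier A" if "b \<in> carrier B" for b
    using hb[OF that] j by auto
  ultimately show ?thesis using cl by (auto simp: hom_def)
qed

lemma ISP_I:
  fixes J :: "'j set" and B :: "('f, 'b) algebra" and A :: "('f, 'a) algebra"
  assumes B: "is_algebra ar B"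
    and h: "h \<in> iso ar B (subalgebra (power_algebra ar A J) S)"
    and S: "subuniverse ar (power_algebra ar A J) S"
  shows "B \<in> ISP ar A"
proof -
  define I where "I = hom ar B A"
  define e where "e = (\<lambda>b \<in> carrier B. \<lambda>\<phi> \<in> I. \<phi> b)"
  have cl: "interp B f x \<in> carrier B" if "x \<in> {..<ar f} \<rightarrow>\<^sub>E carrier B" for f x
    using B that by (auto simp: is_algebra_def subuniverse_def)
  have comp: "compose {..<n} (\<lambda>y. y \<phi>) (compose {..<n} e x) = compose {..<n} \<phi> x"
    if "\<phi> \<in> I" "x \<in> {..<n} \<rightarrow>\<^sub>E carrier B" for \<phi> x n
    using that by (auto simp: compose_def e_def fun_eq_iff restrict_def PiE_iff)
  have e_hom: "e (interp B f x) = interp (power_algebra ar A I) f (compose {..<ar f} e x)"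
    if "x \<in> {..<ar f} \<rightarrow>\<^sub>E carrier B" for f x
  proof
    fix \<phi>
    show "e (interp B f x) \<phi> = interp (power_algebra ar A I) f (compose {..<ar f} e x) \<phi>"
    proof (cases "\<phi> \<in> I")
      case True
      then have "\<phi> (interp B f x) = interp A f (compose {..<ar f} \<phi> x)"
        using that by (auto simp: I_def hom_def)
      then show ?thesis
        using True cl[OF that] by (simp add: e_def power_algebra_def comp[OF True that, unfolded e_def])
    next
      case False
      then show ?thesis using cl[OF that] by (simp add: e_def power_algebra_def)
    qed
  qed
  have eI: "e b \<in> I \<rightarrow>\<^sub>E carrier A" if "b \<in> carrier B" for b
    using that by (auto simp: e_def I_def hom_def)
  have hb: "h b \<in> J \<rightarrow>\<^sub>E carrier A" if "b \<in> carrier B" for b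
    using h S that by (auto simp: iso_def hom_def subalgebra_def subuniverse_def power_algebra_def PiE_iff)
  have proj: "(\<lambda>b \<in> carrier B. h b j) \<in> I" if "j \<in> J" for j
    unfolding I_def by (rule iso_coordinate[OF B h S that])
  have inj: "inj_on e (carrier B)"
  proof (rule inj_onI)
    fix b c assume b: "b \<in> carrier B" and c: "c \<in> carrier B" and eq: "e b = e c"
    have "h b j = h c j" if "j \<in> J" for j
      using fun_cong[OF eq, of "\<lambda>b \<in> carrier B. h b j"] proj[OF that] b c by (simp add: e_def)
    then have "h b = h c" using hb[OF b] hb[OF c] by (blast intro: PiE_ext)
    then show "b = c" using h b c by (auto simp: iso_def bij_betw_def inj_on_def)
  qed
  have sub: "subuniverse ar (power_algebra ar A I) (e ` carrier B)"
    unfolding subuniverse_def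
  proof (intro conjI allI ballI)
    show "e ` carrier B \<noteq> {}" using B by (auto simp: is_algebra_def subuniverse_def)
    show "e ` carrier B \<subseteq> carrier (power_algebra ar A I)"
      using eI by (auto simp: power_algebra_def)
  next
    fix f x assume x: "x \<in> {..<ar f} \<rightarrow>\<^sub>E e ` carrier B"
    define y where "y = compose {..<ar f} (inv_into (carrier B) e) x"
    have y: "y \<in> {..<ar f} \<rightarrow>\<^sub>E carrier B"
      using x by (auto simp: y_def compose_def PiE_iff inv_into_into)
    have "compose {..<ar f} e y k = x k" for k
    proof (cases "k < ar f")
      case True
      then have "x k \<in> e ` carrier B" using x by auto
      then show ?thesis using True by (simp add: y_def compose_def f_inv_into_f)
    next
      case False
      then show ?thesis using PiE_arb[OF x, of k] by (simp add: compose_def)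
    qed
    then have "compose {..<ar f} e y = x" by (rule ext)
    then show "interp (power_algebra ar A I) f x \<in> e ` carrier B"
      using e_hom[OF y] imageI[OF cl[OF y], of e] by simp
  qed
  have "e \<in> iso ar B (subalgebra (power_algebra ar A I) (e ` carrier B))"
  proof -
    have "e \<in> carrier B \<rightarrow>\<^sub>E e ` carrier B" by (simp add: PiE_iff) (simp add: e_def)
    then show ?thesis
      using inj e_hom by (simp add: iso_def hom_def subalgebra_def bij_betw_def power_algebra_def)
  qed
  then show ?thesis using B sub unfolding ISP_def by blast
qed

lemma closedin_hom:
  assumes B: "is_algebra ar B"
  shows "closedin (product_topology (\<lambda>_. discrete_topology (carrier A)) (carrier B)) (hom ar B A)"
    (is "closedin ?T _")
proof -
  have top: "topspace ?T = carrier B \<rightarrow>\<^sub>E carrier A" by simp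
  have "openin ?T (topspace ?T - hom ar B A)"
  proof (subst openin_subopen, intro ballI)
    fix y assume y: "y \<in> topspace ?T - hom ar B A"
    then have yE: "y \<in> carrier B \<rightarrow>\<^sub>E carrier A" by (metis DiffD1 top)
    then obtain f x where x: "x \<in> {..<ar f} \<rightarrow>\<^sub>E carrier B"
      and ne: "y (interp B f x) \<noteq> interp A f (compose {..<ar f} y x)"
      using y unfolding hom_def by blast
    have ix: "interp B f x \<in> carrier B"
      using B x by (auto simp: is_algebra_def subuniverse_def)
    define K where "K = insert (interp B f x) (x ` {..<ar f})"
    define U where "U = (carrier B \<rightarrow>\<^sub>E carrier A) \<inter> {z. \<forall>b\<in>K. z b = y b}"
    have K: "finite K" "K \<subseteq> carrier B" using x ix by (auto simp: K_def)
    have "U = (\<Pi>\<^sub>E b\<in>carrier B. if b \<in> K then {y b} else carrier A)"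
    proof (rule set_eqI)
      fix z
      have "z b \<in> (if b \<in> K then {y b} else carrier A) \<longleftrightarrow> z b \<in> carrier A \<and> (b \<in> K \<longrightarrow> z b = y b)"
        if "b \<in> carrier B" for b
        using yE that by auto
      then show "z \<in> U \<longleftrightarrow> z \<in> (\<Pi>\<^sub>E b\<in>carrier B. if b \<in> K then {y b} else carrier A)"
        using K(2) by (auto simp: U_def PiE_iff)
    qed
    moreover have "openin ?T (\<Pi>\<^sub>E b\<in>carrier B. if b \<in> K then {y b} else carrier A)"
    proof (rule product_topology_basis)
      show "openin (discrete_topology (carrier A)) (if b \<in> K then {y b} else carrier A)" for b
        using K yE by auto
      show "finite {b. (if b \<in> K then {y b} else carrier A) \<noteq> topspace (discrete_topology (carrier A))}"
        by (rule finite_subset[OF _ K(1)]) auto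
    qed
    ultimately have "openin ?T U" by simp
    moreover have "y \<in> U" using yE by (simp add: U_def)
    moreover have "z \<notin> hom ar B A" if z: "z \<in> U" for z
    proof
      assume "z \<in> hom ar B A"
      then have "z (interp B f x) = interp A f (compose {..<ar f} z x)"
        using x by (auto simp: hom_def)
      moreover have "compose {..<ar f} z x = compose {..<ar f} y x"
        using z by (auto simp: U_def K_def compose_def fun_eq_iff)
      ultimately show False using z ne by (simp add: U_def K_def)
    qed
    moreover have "U \<subseteq> topspace ?T" by (simp add: U_def top)
    ultimately show "\<exists>T. openin ?T T \<and> y \<in> T \<and> T \<subseteq> topspace ?T - hom ar B A" by blast
  qed
  then show ?thesis by (auto simp: closedin_def hom_def)
qed

text \<open>Pointwise application of a homomorphism \<open>h\<close> to homomorphisms from \<open>B\<close> to \<open>A\<close>.\<close>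

lemma hom_pointwise:
  assumes B: "is_algebra ar B"
    and h: "h \<in> hom ar (subalgebra (power_algebra ar A {..<n}) d) A"
    and x: "x \<in> {..<n} \<rightarrow>\<^sub>E hom ar B A"
    and d: "\<And>b. b \<in> carrier B \<Longrightarrow> compose {..<n} (\<lambda>y. y b) x \<in> d"
  shows "(\<lambda>b \<in> carrier B. h (compose {..<n} (\<lambda>y. y b) x)) \<in> hom ar B A"
proof -
  let ?g = "\<lambda>b. compose {..<n} (\<lambda>y. y b) x"
  have "h (?g (interp B f z)) = interp A f (compose {..<ar f} (\<lambda>b \<in> carrier B. h (?g b)) z)"
    if z: "z \<in> {..<ar f} \<rightarrow>\<^sub>E carrier B" for f z
  proof -
    have "x k (interp B f z) = interp A f (compose {..<ar f} (x k) z)" if "k < n" for k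
    proof -
      have "x k \<in> hom ar B A" using x that by auto
      then show ?thesis using z by (auto simp: hom_def)
    qed
    moreover have "compose {..<ar f} (\<lambda>y. y k) (compose {..<ar f} ?g z) = compose {..<ar f} (x k) z"
      if "k < n" for k using that by (auto simp: compose_def fun_eq_iff)
    ultimately have "?g (interp B f z) = interp (power_algebra ar A {..<n}) f (compose {..<ar f} ?g z)"
      by (simp add: power_algebra_def compose_def[of "{..<n}" "\<lambda>y. y (interp B f z)"] cong: restrict_cong)
    moreover have "compose {..<ar f} ?g z \<in> {..<ar f} \<rightarrow>\<^sub>E d"
      using z d by (auto simp: compose_def)
    then have "h (interp (power_algebra ar A {..<n}) f (compose {..<ar f} ?g z)) =
        interp A f (compose {..<ar f} h (compose {..<ar f} ?g z))"
      using h by (simp add: hom_def subalgebra_def)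
    moreover have "compose {..<ar f} h (compose {..<ar f} ?g z) =
        compose {..<ar f} (\<lambda>b \<in> carrier B. h (?g b)) z"
      using z by (auto simp: compose_def fun_eq_iff PiE_iff)
    ultimately show ?thesis by simp
  qed
  moreover have "h (?g b) \<in> carrier A" if "b \<in> carrier B" for b
    using h d[OF that] by (auto simp: hom_def subalgebra_def)
  moreover have "interp B f z \<in> carrier B" if "z \<in> {..<ar f} \<rightarrow>\<^sub>E carrier B" for f z
    using B that by (auto simp: is_algebra_def subuniverse_def)
  ultimately show ?thesis by (auto simp: hom_def)
qed

lemma closed_substructure_hom:
  assumes B: "is_algebra ar B"
    and F: "algebraic_operations ar A F" and H: "algebraic_partial_operations ar A H"
  shows "closed_substructure F H (power_structure (alter_ego A) (carrier B)) (hom ar B A)"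
  unfolding closed_substructure_def
proof (intro conjI ballI)
  show "closedin (topology_of (power_structure (alter_ego A) (carrier B))) (hom ar B A)"
    using closedin_hom[OF B] by (simp add: power_structure_def alter_ego_def)
next
  fix s x assume s: "s \<in> F" and x: "x \<in> {..<fst s} \<rightarrow>\<^sub>E hom ar B A"
  obtain n f where nf: "s = (n, f)" by (cases s)
  have "f \<in> hom ar (subalgebra (power_algebra ar A {..<n}) ({..<n} \<rightarrow>\<^sub>E carrier A)) A"
    using F s nf by (auto simp: algebraic_operations_def subalgebra_def power_algebra_def)
  moreover have "compose {..<n} (\<lambda>y. y b) x \<in> {..<n} \<rightarrow>\<^sub>E carrier A" if "b \<in> carrier B" for b
  proof -
    have "x k b \<in> carrier A" if "k < n" for k
    proof -
      have "x k \<in> hom ar B A" using x nf that by auto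
      then show ?thesis using \<open>b \<in> carrier B\<close> by (auto simp: hom_def)
    qed
    then show ?thesis by (simp add: compose_def)
  qed
  ultimately show "operation_of (power_structure (alter_ego A) (carrier B)) s x \<in> hom ar B A"
    using hom_pointwise[OF B, of f A n _ x] x nf by (simp add: power_structure_def alter_ego_def)
next
  fix s x assume s: "s \<in> H" and x: "x \<in> domain_of (power_structure (alter_ego A) (carrier B)) s
    \<inter> ({..<fst s} \<rightarrow>\<^sub>E hom ar B A)"
  obtain n d h where ndh: "s = (n, d, h)" by (cases s)
  have "h \<in> hom ar (subalgebra (power_algebra ar A {..<n}) d) A"
    using H s ndh by (auto simp: algebraic_partial_operations_def)
  then show "partial_operation_of (power_structure (alter_ego A) (carrier B)) s x \<in> hom ar B A"
    using hom_pointwise[OF B, of h A n d x] x ndh by (simp add: power_structure_def alter_ego_def)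
qed

text \<open>
  The evaluation map is always an injective homomorphism; thus a duality fails only if some
  evaluation map is not surjective.
\<close>

lemma points_dual: "topspace (topology_of (dual ar A B)) = hom ar B A"
  by (auto simp: dual_def substructure_def power_structure_def alter_ego_def hom_def)

lemma evaluation_morphism:
  assumes B: "is_algebra ar B"
    and F: "algebraic_operations ar A F" and H: "algebraic_partial_operations ar A H"
    and b: "b \<in> carrier B"
  shows "evaluation ar A B b \<in> morphism_set F H R (dual ar A B) (alter_ego A)"
proof -
  let ?D = "hom ar B A" and ?e = "\<lambda>x \<in> hom ar B A. x b"
  let ?P = "product_topology (\<lambda>_. discrete_topology (carrier A)) (carrier B)"
  let ?X = "power_structure (alter_ego A) (carrier B)"
  have ev: "evaluation ar A B b = ?e" using b by (simp add: evaluation_def)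
  have top: "topology_of (dual ar A B) = subtopology ?P ?D"
    by (simp add: dual_def substructure_def power_structure_def alter_ego_def)
  have dom: "domain_of (dual ar A B) s = domain_of ?X s \<inter> ({..<fst s} \<rightarrow>\<^sub>E ?D)"
    and rel: "relation_of (dual ar A B) t = relation_of ?X t \<inter> ({..<fst t} \<rightarrow>\<^sub>E ?D)"
    and ops: "operation_of (dual ar A B) = operation_of ?X"
    and pops: "partial_operation_of (dual ar A B) = partial_operation_of ?X" for s t
    by (simp_all add: dual_def substructure_def)
  have comp: "compose {..<n} ?e x = compose {..<n} (\<lambda>y. y b) x"
    if x: "x \<in> {..<n} \<rightarrow>\<^sub>E ?D" for n x
  proof -
    have "x k \<in> ?D" if "k < n" for k using x that by auto
    then show ?thesis by (auto simp: compose_def fun_eq_iff)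
  qed
  have closed: "closed_substructure F H ?X ?D" by (rule closed_substructure_hom[OF B F H])
  have "continuous_map (subtopology ?P ?D) (discrete_topology (carrier A)) (\<lambda>x. x b)"
    using b by (intro continuous_map_from_subtopology continuous_map_product_projection)
  then have cont: "continuous_map (subtopology ?P ?D) (discrete_topology (carrier A)) ?e"
    by (rule continuous_map_eq) simp
  have val: "?e \<in> ?D \<rightarrow>\<^sub>E carrier A" using b by (auto simp: hom_def)
  show ?thesis
    unfolding morphism_set_def ev points_dual
  proof (intro CollectI conjI ballI)
    show "?e \<in> ?D \<rightarrow>\<^sub>E points (alter_ego A)"
      using val by (simp add: alter_ego_def)
    show "continuous_map (topology_of (dual ar A B)) (topology_of (alter_ego A)) ?e"
      unfolding top using cont by (simp add: alter_ego_def)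
  next
    fix s x assume s: "s \<in> F" and x: "x \<in> {..<fst s} \<rightarrow>\<^sub>E ?D"
    then have "operation_of ?X s x \<in> ?D"
      using closed unfolding closed_substructure_def by blast
    then show "?e (operation_of (dual ar A B) s x) =
        operation_of (alter_ego A) s (compose {..<fst s} ?e x)"
      using b unfolding comp[OF x] ops by (simp add: power_structure_def)
  next
    fix s x assume s: "s \<in> H" and x: "x \<in> domain_of (dual ar A B) s"
    then have xD: "x \<in> {..<fst s} \<rightarrow>\<^sub>E ?D" and xX: "x \<in> domain_of ?X s" by (auto simp: dom)
    show "compose {..<fst s} ?e x \<in> domain_of (alter_ego A) s"
      using b xX unfolding comp[OF xD] by (simp add: power_structure_def)
    have "partial_operation_of ?X s x \<in> ?D"
      using closed s xD xX unfolding closed_substructure_def by blast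
    then show "?e (partial_operation_of (dual ar A B) s x) =
        partial_operation_of (alter_ego A) s (compose {..<fst s} ?e x)"
      using b unfolding comp[OF xD] pops by (simp add: power_structure_def)
  next
    fix s x assume s: "s \<in> R" and x: "x \<in> relation_of (dual ar A B) s"
    then have xD: "x \<in> {..<fst s} \<rightarrow>\<^sub>E ?D" and xX: "x \<in> relation_of ?X s" by (auto simp: rel)
    show "compose {..<fst s} ?e x \<in> relation_of (alter_ego A) s"
      using b xX unfolding comp[OF xD] by (simp add: power_structure_def)
  qed
qed

lemma evaluation_hom:
  assumes B: "is_algebra ar B"
    and F: "algebraic_operations ar A F" and H: "algebraic_partial_operations ar A H"
  shows "evaluation ar A B \<in> hom ar B (dual_algebra ar A F H R (dual ar A B))"
proof -
  have "evaluation ar A B (interp B f x) =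
      interp (dual_algebra ar A F H R (dual ar A B)) f (compose {..<ar f} (evaluation ar A B) x)"
    if x: "x \<in> {..<ar f} \<rightarrow>\<^sub>E carrier B" for f x
  proof -
    have cl: "interp B f x \<in> carrier B"
      using B x by (auto simp: is_algebra_def subuniverse_def)
    have "\<phi> (interp B f x) = interp A f (compose {..<ar f} (\<lambda>y. y \<phi>)
        (compose {..<ar f} (evaluation ar A B) x))" if \<phi>: "\<phi> \<in> hom ar B A" for \<phi>
    proof -
      have "x k \<in> carrier B" if "k < ar f" for k using x that by auto
      then have "compose {..<ar f} (\<lambda>y. y \<phi>) (compose {..<ar f} (evaluation ar A B) x) =
          compose {..<ar f} \<phi> x"
        using \<phi> by (auto simp: compose_def evaluation_def fun_eq_iff)
      then show ?thesis using \<phi> x by (auto simp: hom_def)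
    qed
    then have "(\<lambda>\<phi> \<in> hom ar B A. \<phi> (interp B f x)) = (\<lambda>\<phi> \<in> hom ar B A. interp A f
        (compose {..<ar f} (\<lambda>y. y \<phi>) (compose {..<ar f} (evaluation ar A B) x)))"
      by (rule restrict_ext)
    then show ?thesis
      using cl unfolding dual_algebra_def points_dual
      by (simp add: subalgebra_def power_algebra_def evaluation_def[of ar A B, THEN fun_cong, of "interp B f x"])
  qed
  moreover have "evaluation ar A B \<in> carrier B \<rightarrow>\<^sub>E morphism_set F H R (dual ar A B) (alter_ego A)"
    using evaluation_morphism[OF B F H] by (simp add: PiE_iff) (simp add: evaluation_def)
  ultimately show ?thesis
    by (simp add: hom_def[of ar B "dual_algebra ar A F H R (dual ar A B)"])
      (simp add: dual_algebra_def subalgebra_def)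
qed

lemma evaluation_inj:
  fixes B :: "('f, 'b) algebra" and A :: "('f, 'a) algebra"
  assumes B: "B \<in> ISP ar A"
  shows "inj_on (evaluation ar A B) (carrier B)"
proof (rule inj_onI)
  fix b c assume b: "b \<in> carrier B" and c: "c \<in> carrier B"
    and eq: "evaluation ar A B b = evaluation ar A B c"
  obtain J :: "('b \<Rightarrow> 'a) set" and S h where alg: "is_algebra ar B"
    and S: "subuniverse ar (power_algebra ar A J) S"
    and h: "h \<in> iso ar B (subalgebra (power_algebra ar A J) S)"
    using B unfolding ISP_def by blast
  have hb: "h b \<in> J \<rightarrow>\<^sub>E carrier A" if "b \<in> carrier B" for b
    using h S that by (auto simp: iso_def hom_def subalgebra_def subuniverse_def power_algebra_def PiE_iff)
  have "h b j = h c j" if "j \<in> J" for j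
    using fun_cong[OF eq, of "\<lambda>b \<in> carrier B. h b j"] iso_coordinate[OF alg h S that] b c
    by (simp add: evaluation_def)
  then have "h b = h c" using hb[OF b] hb[OF c] by (blast intro: PiE_ext)
  then show "b = c" using h b c by (auto simp: iso_def bij_betw_def inj_on_def)
qed

end

theory Submission
  imports Defs "HOL-Number_Theory.Cong"
begin

text \<open>
  Let \<open>B\<close> be a subalgebra of a power of \<open>A\<close> and \<open>c\<close> a sequence in \<open>B\<close> such that every homomorphism
  \<open>B \<rightarrow> A\<close> is constant along \<open>c\<close> up to at most \<open>m\<close> exceptions.  Assigning to each homomorphism its
  almost constant value is continuous and agrees on every finite set with the evaluation at some
  \<open>c i\<close>, hence is a morphism for every algebraic structure on \<open>A\<close>.  A duality would make it an
  evaluation at an element of \<open>B\<close>, namely at the pointwise limit of \<open>c\<close>; so \<open>A\<close> is not dualizable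
  if this ghost element is missing from \<open>B\<close>.

  For \<open>\<int>/8\<close>, let \<open>t\<close> and \<open>h j\<close> (\<open>j \<in> \<nat>\<close>) be the 0-1-valued functions on \<open>{0, 1} \<times> \<nat>\<close> where \<open>t\<close> is the
  first projection and \<open>h j\<close> is supported on the second coordinates \<open>0\<close> and \<open>j + 1\<close>.
  The products of \<open>2 (h i)\<close> and \<open>2 (h j)\<close> for \<open>i \<noteq> j\<close> all coincide, so under a homomorphism the
  images of the \<open>2 (h j)\<close> have the same residue modulo 4 with at most one exception, and
  \<open>c j = (2 t) (2 (h j))\<close> is constant up to one exception.  The limit of \<open>c\<close> is \<open>4\<close> times the
  indicator of the point \<open>(1, 0)\<close>.  It would be a cubic expression in \<open>t\<close> and the \<open>h j\<close>, whereas only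
  quadratic ones survive in the subring generated by \<open>2 t\<close> and the \<open>2 (h j)\<close>.
\<close>

section \<open>Homomorphisms and copies of countable algebras\<close>

lemma hom_app:
  assumes "h \<in> hom ar A B" "x \<in> {..<ar f} \<rightarrow>\<^sub>E carrier A"
  shows "h (interp A f x) = interp B f (compose {..<ar f} h x)"
  using assms by (auto simp: hom_def)

lemma hom_compose:
  assumes A: "is_algebra ar A" and g: "g \<in> hom ar A B" and h: "h \<in> hom ar B C"
  shows "compose (carrier A) h g \<in> hom ar A C"
proof -
  have gE: "g \<in> carrier A \<rightarrow>\<^sub>E carrier B" and hE: "h \<in> carrier B \<rightarrow>\<^sub>E carrier C"
    using g h by (auto simp: hom_def)
  have "compose (carrier A) h g (interp A f x) =
      interp C f (compose {..<ar f} (compose (carrier A) h g) x)"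
    if x: "x \<in> {..<ar f} \<rightarrow>\<^sub>E carrier A" for f x
  proof -
    have "interp A f x \<in> carrier A"
      using A x by (auto simp: is_algebra_def subuniverse_def)
    then have "compose (carrier A) h g (interp A f x) = h (interp B f (compose {..<ar f} g x))"
      using hom_app[OF g x] by (simp add: compose_def)
    also have "\<dots> = interp C f (compose {..<ar f} h (compose {..<ar f} g x))"
      using x gE by (intro hom_app[OF h]) (auto simp: compose_def)
    also have "compose {..<ar f} h (compose {..<ar f} g x) = compose {..<ar f} (compose (carrier A) h g) x"
      using x by (auto simp: compose_def fun_eq_iff)
    finally show ?thesis .
  qed
  moreover have "compose (carrier A) h g \<in> carrier A \<rightarrow>\<^sub>E carrier C"
    using gE hE by (auto simp: compose_def)
  ultimately show ?thesis by (simp add: hom_def)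
qed

text \<open>Dualizability is tested on algebras whose elements have the fixed type
  \<open>'b\<close>. An injection of the natural numbers into \<open>'b\<close> carries every
  countable algebra there.\<close>

lemma countable_algebra_copy:
  fixes B :: "('f, 'c) algebra"
  assumes inf: "infinite (UNIV :: 'b set)" and cnt: "countable (carrier B)"
    and B: "is_algebra ar B"
  obtains C :: "('f, 'b) algebra" and \<psi> \<iota>
  where "is_algebra ar C" "\<psi> \<in> iso ar C B" "\<iota> \<in> hom ar B C"
    "\<And>b. b \<in> carrier B \<Longrightarrow> \<psi> (\<iota> b) = b"
proof -
  obtain e :: "nat \<Rightarrow> 'b" where e: "inj e"
    using inf by (auto simp: infinite_iff_countable_subset)
  let ?B = "carrier B"
  define \<iota> where "\<iota> = (\<lambda>b \<in> ?B. e (to_nat_on ?B b))"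
  have inj: "inj_on \<iota> ?B"
    using inj_on_to_nat_on[OF cnt] e by (auto simp: inj_on_def \<iota>_def)
  define \<psi> where "\<psi> = (\<lambda>c \<in> \<iota> ` ?B. inv_into ?B \<iota> c)"
  define C where "C = \<lparr>carrier = \<iota> ` ?B,
    interp = (\<lambda>f x. \<iota> (interp B f (compose {..<ar f} \<psi> x)))\<rparr>"
  have cl: "interp B f x \<in> ?B" if "x \<in> {..<ar f} \<rightarrow>\<^sub>E ?B" for f x
    using B that by (auto simp: is_algebra_def subuniverse_def)
  have \<psi>\<iota>: "\<psi> (\<iota> b) = b" if "b \<in> ?B" for b
    using that inj by (simp add: \<psi>_def)
  have \<psi>B: "compose {..<n} \<psi> x \<in> {..<n} \<rightarrow>\<^sub>E ?B" if "x \<in> {..<n} \<rightarrow>\<^sub>E \<iota> ` ?B" for n x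
  proof -
    have "\<psi> (x k) \<in> ?B" if "k < n" for k
    proof -
      have "x k \<in> \<iota> ` ?B" using \<open>x \<in> _\<close> that by auto
      then show ?thesis using \<psi>\<iota> by auto
    qed
    then show ?thesis by (auto simp: compose_def)
  qed
  have "is_algebra ar C"
    using B cl[OF \<psi>B] by (simp add: is_algebra_def subuniverse_def C_def)
  moreover have "bij_betw \<psi> (\<iota> ` ?B) ?B"
    using \<psi>\<iota> by (intro bij_betwI[where g = \<iota>]) auto
  moreover have "\<psi> \<in> hom ar C B"
  proof -
    have "\<psi> \<in> \<iota> ` ?B \<rightarrow>\<^sub>E ?B" using \<psi>\<iota> by (auto simp: PiE_iff) (simp add: \<psi>_def)
    then show ?thesis using \<psi>\<iota>[OF cl[OF \<psi>B]] by (simp add: hom_def C_def)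
  qed
  moreover have "\<iota> (interp B f x) = interp C f (compose {..<ar f} \<iota> x)"
    if x: "x \<in> {..<ar f} \<rightarrow>\<^sub>E ?B" for f x
  proof -
    have "x k \<in> ?B" if "k < ar f" for k using x that by auto
    then have "compose {..<ar f} \<psi> (compose {..<ar f} \<iota> x) = x"
      using x \<psi>\<iota> by (auto simp: compose_def fun_eq_iff PiE_iff extensional_def)
    then show ?thesis by (simp add: C_def)
  qed
  then have "\<iota> \<in> hom ar B C"
    by (auto simp: hom_def C_def \<iota>_def)
  ultimately show thesis
    using that \<psi>\<iota> by (auto simp: iso_def C_def)
qed

section \<open>Ghost elements as obstructions to a duality\<close>

text \<open>Each preservation condition involves finitely many points only: the arguments and, for
  an operation, its value. There \<open>\<phi>\<close> coincides with an evaluation, which is a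
  morphism.\<close>

lemma locally_evaluation_morphism:
  assumes B: "is_algebra ar B"
    and F: "algebraic_operations ar A F" and H: "algebraic_partial_operations ar A H"
    and ext: "\<phi> \<in> extensional (hom ar B A)"
    and cont: "continuous_map (topology_of (dual ar A B)) (discrete_topology (carrier A)) \<phi>"
    and loc: "\<And>X. finite X \<Longrightarrow> \<exists>b \<in> carrier B. \<forall>x\<in>X. \<phi> x = evaluation ar A B b x"
  shows "\<phi> \<in> morphism_set F H R (dual ar A B) (alter_ego A)"
proof -
  let ?X = "dual ar A B" and ?M = "morphism_set F H R (dual ar A B) (alter_ego A)"
  have agree: "\<exists>\<epsilon>\<in>?M. \<phi> z = \<epsilon> z \<and> compose {..<n} \<phi> x = compose {..<n} \<epsilon> x"
    for z and x :: "nat \<Rightarrow> _" and n :: nat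
  proof -
    obtain b where b: "b \<in> carrier B" "\<forall>y\<in>insert z (x ` {..<n}). \<phi> y = evaluation ar A B b y"
      using loc[of "insert z (x ` {..<n})"] by auto
    then have "compose {..<n} \<phi> x = compose {..<n} (evaluation ar A B b) x"
      by (auto simp: compose_def fun_eq_iff)
    then show ?thesis using b evaluation_morphism[OF B F H b(1)] by blast
  qed
  have "\<phi> z \<in> carrier A" if "z \<in> points ?X" for z
    using continuous_map_funspace[OF cont] that by auto
  then have "\<phi> \<in> points ?X \<rightarrow>\<^sub>E points (alter_ego A)"
    using ext by (auto simp: points_dual alter_ego_def PiE_iff)
  moreover have "\<phi> (operation_of ?X s x) = operation_of (alter_ego A) s (compose {..<fst s} \<phi> x)"
    if "s \<in> F" "x \<in> {..<fst s} \<rightarrow>\<^sub>E points ?X" for s x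
    using agree[of "operation_of ?X s x" "fst s" x] that by (auto simp: morphism_set_def)
  moreover have "compose {..<fst s} \<phi> x \<in> domain_of (alter_ego A) s \<and>
      \<phi> (partial_operation_of ?X s x) = partial_operation_of (alter_ego A) s (compose {..<fst s} \<phi> x)"
    if "s \<in> H" "x \<in> domain_of ?X s" for s x
    using agree[of "partial_operation_of ?X s x" "fst s" x] that by (auto simp: morphism_set_def)
  moreover have "compose {..<fst s} \<phi> x \<in> relation_of (alter_ego A) s"
    if "s \<in> R" "x \<in> relation_of ?X s" for s x
  proof -
    \<comment> \<open>A relation has no value to compare, so the extra point is a dummy.\<close>
    obtain \<epsilon> where "\<epsilon> \<in> ?M" "compose {..<fst s} \<phi> x = compose {..<fst s} \<epsilon> x"
      using agree[of undefined "fst s" x] by blast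
    then show ?thesis using that by (simp add: morphism_set_def)
  qed
  ultimately show ?thesis
    using cont by (simp add: morphism_set_def alter_ego_def)
qed

lemma continuous_map_locally_constant:
  assumes ext: "\<And>x. x \<in> topspace X \<Longrightarrow> f x \<in> D"
    and loc: "\<And>x. x \<in> topspace X \<Longrightarrow> \<exists>U. openin X U \<and> x \<in> U \<and> (\<forall>y\<in>U. f y = f x)"
  shows "continuous_map X (discrete_topology D) f"
  unfolding continuous_map_def
proof (intro conjI allI impI)
  show "f \<in> topspace X \<rightarrow> topspace (discrete_topology D)" using ext by auto
  fix V
  show "openin X {x \<in> topspace X. f x \<in> V}"
  proof (subst openin_subopen, intro ballI)
    fix x assume x: "x \<in> {x \<in> topspace X. f x \<in> V}"
    then obtain U where U: "openin X U" "x \<in> U" "\<forall>y\<in>U. f y = f x" using loc by blast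
    moreover have "U \<subseteq> {x \<in> topspace X. f x \<in> V}"
      using U x openin_subset by fastforce
    ultimately show "\<exists>T. openin X T \<and> x \<in> T \<and> T \<subseteq> {x \<in> topspace X. f x \<in> V}" by blast
  qed
qed

text \<open>Prescribing finitely many coordinates is an open condition in a product of discrete
  spaces. These sets serve as neighbourhoods on which the almost constant value does not
  change.\<close>

lemma openin_dual_agree:
  assumes x: "x \<in> hom ar B A" and K: "finite K" "K \<subseteq> carrier B"
  shows "openin (topology_of (dual ar A B)) {y \<in> hom ar B A. \<forall>b\<in>K. y b = x b}"
proof -
  let ?P = "product_topology (\<lambda>_. discrete_topology (carrier A)) (carrier B)"
  let ?U = "\<Pi>\<^sub>E b\<in>carrier B. if b \<in> K then {x b} else carrier A"
  have xE: "x b \<in> carrier A" if "b \<in> carrier B" for b using x that by (auto simp: hom_def)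
  have "openin ?P ?U"
  proof (rule product_topology_basis)
    show "openin (discrete_topology (carrier A)) (if b \<in> K then {x b} else carrier A)" for b
      using K xE by auto
    show "finite {b. (if b \<in> K then {x b} else carrier A) \<noteq> topspace (discrete_topology (carrier A))}"
      by (rule finite_subset[OF _ K(1)]) auto
  qed
  moreover have "{y \<in> hom ar B A. \<forall>b\<in>K. y b = x b} = ?U \<inter> hom ar B A"
  proof (intro equalityI subsetI)
    fix y assume y: "y \<in> {y \<in> hom ar B A. \<forall>b\<in>K. y b = x b}"
    then have "y \<in> carrier B \<rightarrow>\<^sub>E carrier A" by (simp add: hom_def)
    then show "y \<in> ?U \<inter> hom ar B A" using y by (auto simp: PiE_iff)
  next
    fix y assume "y \<in> ?U \<inter> hom ar B A"
    then have "y \<in> hom ar B A" "\<And>b. b \<in> carrier B \<Longrightarrow> y b \<in> (if b \<in> K then {x b} else carrier A)"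
      by (auto simp: PiE_iff)
    then show "y \<in> {y \<in> hom ar B A. \<forall>b\<in>K. y b = x b}" using K(2) by fastforce
  qed
  ultimately have "openin (subtopology ?P (hom ar B A)) {y \<in> hom ar B A. \<forall>b\<in>K. y b = x b}"
    by (auto simp: openin_subtopology)
  then show ?thesis
    by (simp add: dual_def substructure_def power_structure_def alter_ego_def)
qed

text \<open>
  Sending a homomorphism \<open>x\<close> to the value that \<open>x (c i)\<close> takes for almost all \<open>i\<close> is continuous,
  since this value is the majority value among the first \<open>2 * m + 1\<close> ones.
\<close>

lemma ghost_evaluation:
  fixes B :: "('f, 'b) algebra" and A :: "('f, 'a) algebra" and c :: "nat \<Rightarrow> 'b"
  assumes dual: "yields_duality TYPE('b) ar A F H R"
    and F: "algebraic_operations ar A F" and H: "algebraic_partial_operations ar A H"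
    and B: "B \<in> ISP ar A"
    and c: "\<And>i. c i \<in> carrier B"
    and v: "\<And>x. x \<in> hom ar B A \<Longrightarrow> \<exists>v. finite {i. x (c i) \<noteq> v} \<and> card {i. x (c i) \<noteq> v} \<le> m"
  shows "\<exists>b \<in> carrier B. \<forall>x \<in> hom ar B A. finite {i. x (c i) \<noteq> x b}"
proof -
  let ?D = "hom ar B A"
  have alg: "is_algebra ar B" using B by (simp add: ISP_def)
  obtain w where w: "\<And>x. x \<in> ?D \<Longrightarrow> finite {i. x (c i) \<noteq> w x}"
    and wm: "\<And>x. x \<in> ?D \<Longrightarrow> card {i. x (c i) \<noteq> w x} \<le> m"
    using v by metis
  \<comment> \<open>Finitely many finite exceptional sets miss some index, so one \<open>c i\<close>
    serves all of \<open>X\<close>.\<close>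
  have common: "\<exists>i. \<forall>x\<in>X. x (c i) = w x" if X: "finite X" "X \<subseteq> ?D" for X
  proof -
    have "finite (\<Union>x\<in>X. {i. x (c i) \<noteq> w x})" using X w by blast
    then obtain i where "i \<notin> (\<Union>x\<in>X. {i. x (c i) \<noteq> w x})"
      using ex_new_if_finite infinite_UNIV_nat by blast
    then show ?thesis by blast
  qed
  define \<phi> where "\<phi> = restrict w ?D"
  have w_eq: "w y = w x" if x: "x \<in> ?D" and y: "y \<in> ?D" and eq: "\<And>i. i \<le> 2 * m \<Longrightarrow> y (c i) = x (c i)"
    for x y
  proof -
    let ?E = "{i. x (c i) \<noteq> w x} \<union> {i. y (c i) \<noteq> w y}"
    \<comment> \<open>Each of \<open>x\<close> and \<open>y\<close> has at most \<open>m\<close>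
      exceptions, so one of the \<open>2 * m + 1\<close> indices up to \<open>2 * m\<close> is an
      exception for neither.\<close>
    have "card ?E \<le> 2 * m"
      using card_Un_le[of "{i. x (c i) \<noteq> w x}" "{i. y (c i) \<noteq> w y}"] wm[OF x] wm[OF y] by linarith
    then have "\<not> {..2 * m} \<subseteq> ?E"
      using card_mono[of ?E "{..2 * m}"] w[OF x] w[OF y] by auto
    then show ?thesis using eq by auto
  qed
  have "continuous_map (topology_of (dual ar A B)) (discrete_topology (carrier A)) \<phi>"
  proof (rule continuous_map_locally_constant)
    fix x assume "x \<in> points (dual ar A B)"
    then have x: "x \<in> ?D" by (simp add: points_dual)
    obtain i where "x (c i) = w x" using common[of "{x}"] x by auto
    moreover have "x (c i) \<in> carrier A" using x c by (auto simp: hom_def)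
    ultimately show "\<phi> x \<in> carrier A" using x by (simp add: \<phi>_def)
    have "openin (topology_of (dual ar A B)) {y \<in> ?D. \<forall>b\<in>c ` {..2 * m}. y b = x b}"
      using c by (intro openin_dual_agree[OF x]) auto
    moreover have "\<phi> y = \<phi> x" if "y \<in> {y \<in> ?D. \<forall>b\<in>c ` {..2 * m}. y b = x b}" for y
      using that x w_eq[OF x, of y] by (simp add: \<phi>_def)
    ultimately show "\<exists>U. openin (topology_of (dual ar A B)) U \<and> x \<in> U \<and> (\<forall>y\<in>U. \<phi> y = \<phi> x)"
      using x by blast
  qed
  moreover have "\<exists>b \<in> carrier B. \<forall>x\<in>X. \<phi> x = evaluation ar A B b x" if X: "finite X" for X
  proof -
    \<comment> \<open>Outside \<open>?D\<close> both sides have the default value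
      \<open>undefined\<close>, so only \<open>X \<inter> ?D\<close> matters.\<close>
    obtain i where "\<forall>x\<in>X \<inter> ?D. x (c i) = w x" using common[of "X \<inter> ?D"] X by auto
    then have "\<forall>x\<in>X. \<phi> x = evaluation ar A B (c i) x" using c by (auto simp: \<phi>_def evaluation_def)
    then show ?thesis using c by blast
  qed
  ultimately have "\<phi> \<in> morphism_set F H R (dual ar A B) (alter_ego A)"
    by (intro locally_evaluation_morphism[OF alg F H]) (auto simp: \<phi>_def)
  moreover have "evaluation ar A B \<in> iso ar B (dual_algebra ar A F H R (dual ar A B))"
    using dual B by (simp add: yields_duality_def)
  \<comment> \<open>Surjectivity of the evaluation map turns \<open>\<phi>\<close> into an
    evaluation.\<close>
  ultimately obtain b where b: "b \<in> carrier B" "\<phi> = evaluation ar A B b"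
    by (auto simp: iso_def bij_betw_def dual_algebra_def subalgebra_def)
  have "w x = x b" if "x \<in> ?D" for x
    using fun_cong[OF b(2), of x] that b(1) by (simp add: \<phi>_def evaluation_def)
  then show ?thesis using b(1) w by (intro bexI[of _ b]) auto
qed

text \<open>Coordinate projections are homomorphisms, so the element supplied by a duality has the
  same coordinates as the limit \<open>g\<close> of \<open>c\<close>, which lies outside
  \<open>S\<close>. Countability of \<open>S\<close> permits a copy in the type
  \<open>'b\<close>.\<close>

theorem ghost_element:
  fixes A :: "('f, 'a) algebra" and S :: "('i \<Rightarrow> 'a) set" and c :: "nat \<Rightarrow> 'i \<Rightarrow> 'a"
  assumes inf: "infinite (UNIV :: 'b set)"
    and S: "subuniverse ar (power_algebra ar A I) S" and cnt: "countable S"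
    and c: "\<And>i. c i \<in> S"
    and v: "\<And>x. x \<in> hom ar (subalgebra (power_algebra ar A I) S) A \<Longrightarrow>
      \<exists>v. finite {i. x (c i) \<noteq> v} \<and> card {i. x (c i) \<noteq> v} \<le> m"
    and g: "g \<in> extensional I" "g \<notin> S" "\<And>j. j \<in> I \<Longrightarrow> finite {i. c i j \<noteq> g j}"
  shows "\<not> dualizable TYPE('b) ar A"
proof
  assume "dualizable TYPE('b) ar A"
  then obtain F H R where F: "algebraic_operations ar A F"
    and H: "algebraic_partial_operations ar A H" and dual: "yields_duality TYPE('b) ar A F H R"
    by (auto simp: dualizable_def)
  let ?S = "subalgebra (power_algebra ar A I) S"
  have S': "is_algebra ar ?S" "carrier ?S = S"
    using S by (auto simp: is_algebra_def subuniverse_def subalgebra_def)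
  obtain B :: "('f, 'b) algebra" and \<psi> \<iota> where B: "is_algebra ar B" and \<psi>: "\<psi> \<in> iso ar B ?S"
    and \<iota>: "\<iota> \<in> hom ar ?S B" and \<psi>\<iota>: "\<And>b. b \<in> S \<Longrightarrow> \<psi> (\<iota> b) = b"
    using countable_algebra_copy[OF inf, of ?S ar] S' cnt by auto
  have "\<exists>v. finite {i. x (\<iota> (c i)) \<noteq> v} \<and> card {i. x (\<iota> (c i)) \<noteq> v} \<le> m" if "x \<in> hom ar B A" for x
    using v[OF hom_compose[OF S'(1) \<iota> that]] c S'(2) by (simp add: compose_def)
  moreover have "\<iota> (c i) \<in> carrier B" for i using \<iota> c S'(2) by (auto simp: hom_def)
  ultimately obtain b where b: "b \<in> carrier B" "\<forall>x \<in> hom ar B A. finite {i. x (\<iota> (c i)) \<noteq> x b}"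
    using ghost_evaluation[OF dual F H ISP_I[OF B \<psi> S], of "\<lambda>i. \<iota> (c i)" m] by blast
  have "\<psi> b \<in> S" using \<psi> b(1) S'(2) by (auto simp: iso_def hom_def)
  have "\<psi> b j = g j" if j: "j \<in> I" for j
  proof -
    have "finite {i. c i j \<noteq> \<psi> b j}"
      using bspec[OF b(2) iso_coordinate[OF B \<psi> S j]] b(1) \<open>\<And>i. \<iota> (c i) \<in> carrier B\<close> \<psi>\<iota>[OF c]
      by simp
    then have "finite ({i. c i j \<noteq> \<psi> b j} \<union> {i. c i j \<noteq> g j})" using g(3)[OF j] by simp
    then obtain i where "i \<notin> {i. c i j \<noteq> \<psi> b j} \<union> {i. c i j \<noteq> g j}"
      using ex_new_if_finite infinite_UNIV_nat by blast
    then show ?thesis by simp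
  qed
  moreover have "\<psi> b \<in> extensional I"
    using \<open>\<psi> b \<in> S\<close> S by (fastforce simp: subuniverse_def power_algebra_def PiE_iff)
  ultimately have "\<psi> b = g" using g(1) by (blast intro: extensionalityI)
  then show False using \<open>\<psi> b \<in> S\<close> g(2) by simp
qed

section \<open>A countable subring of a power of \<open>Z8\<close>\<close>

text \<open>
  Closed conditions, satisfied by \<open>t\<close> and the \<open>h j\<close>, that exclude half of the ghost element.  For a
  finite combination \<open>z\<close> of constants and functions supported on \<open>{0, j + 1}\<close> with equal values
  at both points, \<open>z 0\<close> exceeds the limit of \<open>z\<close> by as much as all other values together do; the sum
  conditions express this with \<open>a\<close>, \<open>b\<close> as the limits of \<open>w False\<close>, \<open>w True\<close>.
\<close>

definition balanced :: "(bool \<Rightarrow> nat \<Rightarrow> int) \<Rightarrow> bool" where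
  "balanced w \<longleftrightarrow> (\<exists>a b.
     (\<forall>\<^sub>F n in sequentially. [w False n = a] (mod 4) \<and> [w True n = b] (mod 4) \<and>
        [(\<Sum>k=1..n. w False k) = w False 0 + (int n - 1) * a] (mod 2) \<and>
        [(\<Sum>k=1..n. w True k - w False k) = w True 0 - w False 0 + (int n - 1) * (b - a)] (mod 4)) \<and>
     (\<forall>k. [w True k - w False k = b - a] (mod 2)))"

text \<open>All conditions are linear in the function and its two limits, so the limits add
  up.\<close>

lemma balanced_add:
  assumes "balanced v" "balanced w"
  shows "balanced (\<lambda>i k. v i k + w i k)"
proof -
  obtain a b where v: "\<forall>\<^sub>F n in sequentially. [v False n = a] (mod 4) \<and> [v True n = b] (mod 4) \<and>
        [(\<Sum>k=1..n. v False k) = v False 0 + (int n - 1) * a] (mod 2) \<and>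
        [(\<Sum>k=1..n. v True k - v False k) = v True 0 - v False 0 + (int n - 1) * (b - a)] (mod 4)"
      and v2: "\<And>k. [v True k - v False k = b - a] (mod 2)"
    using assms(1) unfolding balanced_def by blast
  obtain c d where w: "\<forall>\<^sub>F n in sequentially. [w False n = c] (mod 4) \<and> [w True n = d] (mod 4) \<and>
        [(\<Sum>k=1..n. w False k) = w False 0 + (int n - 1) * c] (mod 2) \<and>
        [(\<Sum>k=1..n. w True k - w False k) = w True 0 - w False 0 + (int n - 1) * (d - c)] (mod 4)"
      and w2: "\<And>k. [w True k - w False k = d - c] (mod 2)"
    using assms(2) unfolding balanced_def by blast
  show ?thesis
    unfolding balanced_def
  proof (rule exI[of _ "a + c"], rule exI[of _ "b + d"], intro conjI allI)
    show "[v True k + w True k - (v False k + w False k) = b + d - (a + c)] (mod 2)" for k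
      using cong_add[OF v2[of k] w2[of k]] by (simp add: algebra_simps)
    show "\<forall>\<^sub>F n in sequentially. [v False n + w False n = a + c] (mod 4) \<and>
        [v True n + w True n = b + d] (mod 4) \<and>
        [(\<Sum>k=1..n. v False k + w False k) = v False 0 + w False 0 + (int n - 1) * (a + c)] (mod 2) \<and>
        [(\<Sum>k=1..n. v True k + w True k - (v False k + w False k)) =
          v True 0 + w True 0 - (v False 0 + w False 0) + (int n - 1) * (b + d - (a + c))] (mod 4)"
      using v w
    proof eventually_elim
      case (elim n)
      have sum: "(\<Sum>k=1..n. v True k + w True k - (v False k + w False k)) =
          (\<Sum>k=1..n. v True k - v False k) + (\<Sum>k=1..n. w True k - w False k)"
        unfolding sum.distrib[symmetric] by (rule sum.cong) auto
      have rhs: "v False 0 + w False 0 + (int n - 1) * (a + c) =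
          (v False 0 + (int n - 1) * a) + (w False 0 + (int n - 1) * c)"
        "v True 0 + w True 0 - (v False 0 + w False 0) + (int n - 1) * (b + d - (a + c)) =
          (v True 0 - v False 0 + (int n - 1) * (b - a)) + (w True 0 - w False 0 + (int n - 1) * (d - c))"
        by (simp_all add: algebra_simps)
      show ?case
        unfolding sum rhs sum.distrib[of "v False"] using elim by (simp add: cong_add)
    qed
  qed
qed

text \<open>A discrete Leibniz rule, used to compare the rows \<open>True\<close> and
  \<open>False\<close> of a product.\<close>

lemma cong_mult_difference:
  fixes x x' y y' p q :: int
  assumes "[x' - x = p] (mod m)" "[y' - y = q] (mod m)"
  shows "[x' * y' - x * y = x * q + y * p + p * q] (mod m)"
proof -
  have "x' * y' - x * y = x * (y' - y) + y * (x' - x) + (x' - x) * (y' - y)"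
    by (simp add: algebra_simps)
  then show ?thesis using assms by (simp add: cong_add cong_mult)
qed

lemma cong_double:
  fixes x y :: int
  assumes "[x = y] (mod 2)"
  shows "[2 * x = 2 * y] (mod 4)"
  using cong_cmult_leftI[OF assms, of 2] by simp

text \<open>By the Leibniz rule and the constant parity of the row differences, the row difference
  of \<open>v * w\<close> is modulo 2 linear in \<open>v False\<close> and \<open>w False\<close>.
  The factor 2 lifts this to modulo 4, so sums of \<open>v False\<close> and \<open>w False\<close>
  are needed modulo 2 only. The conditions modulo 2 on the new function hold because it is
  even.\<close>

lemma balanced_mult:
  assumes "balanced v" "balanced w"
  shows "balanced (\<lambda>i k. 2 * (v i k * w i k))"
proof -
  obtain a b where v: "\<forall>\<^sub>F n in sequentially. [v False n = a] (mod 4) \<and> [v True n = b] (mod 4) \<and>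
        [(\<Sum>k=1..n. v False k) = v False 0 + (int n - 1) * a] (mod 2) \<and>
        [(\<Sum>k=1..n. v True k - v False k) = v True 0 - v False 0 + (int n - 1) * (b - a)] (mod 4)"
      and v2: "\<And>k. [v True k - v False k = b - a] (mod 2)"
    using assms(1) unfolding balanced_def by blast
  obtain c d where w: "\<forall>\<^sub>F n in sequentially. [w False n = c] (mod 4) \<and> [w True n = d] (mod 4) \<and>
        [(\<Sum>k=1..n. w False k) = w False 0 + (int n - 1) * c] (mod 2) \<and>
        [(\<Sum>k=1..n. w True k - w False k) = w True 0 - w False 0 + (int n - 1) * (d - c)] (mod 4)"
      and w2: "\<And>k. [w True k - w False k = d - c] (mod 2)"
    using assms(2) unfolding balanced_def by blast
  let ?p = "b - a" and ?q = "d - c"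
  let ?D = "\<lambda>k. 2 * (v True k * w True k) - 2 * (v False k * w False k)"
  have D: "[?D k = 2 * (v False k * ?q + w False k * ?p + ?p * ?q)] (mod 4)" for k
    using cong_double[OF cong_mult_difference[OF v2[of k] w2[of k]]] by (simp add: algebra_simps)
  show ?thesis
    unfolding balanced_def
  proof (rule exI[of _ "2 * (a * c)"], rule exI[of _ "2 * (b * d)"], intro conjI allI)
    show "[?D k = 2 * (b * d) - 2 * (a * c)] (mod 2)" for k
      by (simp add: cong_def)
    show "\<forall>\<^sub>F n in sequentially. [2 * (v False n * w False n) = 2 * (a * c)] (mod 4) \<and>
        [2 * (v True n * w True n) = 2 * (b * d)] (mod 4) \<and>
        [(\<Sum>k=1..n. 2 * (v False k * w False k)) =
          2 * (v False 0 * w False 0) + (int n - 1) * (2 * (a * c))] (mod 2) \<and>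
        [(\<Sum>k=1..n. ?D k) = ?D 0 + (int n - 1) * (2 * (b * d) - 2 * (a * c))] (mod 4)"
      using v w
    proof eventually_elim
      case (elim n)
      let ?V = "\<Sum>k=1..n. v False k" and ?W = "\<Sum>k=1..n. w False k"
      let ?N = "int n - 1"
      have "[(\<Sum>k=1..n. ?D k) = (\<Sum>k=1..n. 2 * (v False k * ?q + w False k * ?p + ?p * ?q))] (mod 4)"
        using D by (rule cong_sum)
      also have "(\<Sum>k=1..n. 2 * (v False k * ?q + w False k * ?p + ?p * ?q)) =
          2 * (?V * ?q + ?W * ?p + int n * (?p * ?q))"
        by (simp add: sum.distrib sum_distrib_left[symmetric] sum_distrib_right[symmetric])
      \<comment> \<open>The sum conditions modulo 2 on both factors enter here.\<close>
      also have "[2 * (?V * ?q + ?W * ?p + int n * (?p * ?q)) =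
          2 * ((v False 0 + ?N * a) * ?q + (w False 0 + ?N * c) * ?p + int n * (?p * ?q))] (mod 4)"
        using elim by (intro cong_double cong_add cong_mult) simp_all
      \<comment> \<open>One of the \<open>n\<close> copies of \<open>?p * ?q\<close> goes to the
        point 0; the other \<open>?N\<close> use
        \<open>a * ?q + c * ?p + ?p * ?q = b * d - a * c\<close>.\<close>
      also have "2 * ((v False 0 + ?N * a) * ?q + (w False 0 + ?N * c) * ?p + int n * (?p * ?q)) =
          2 * (v False 0 * ?q + w False 0 * ?p + ?p * ?q) + ?N * (2 * (b * d) - 2 * (a * c))"
        by (simp add: algebra_simps)
      also have "[2 * (v False 0 * ?q + w False 0 * ?p + ?p * ?q) + ?N * (2 * (b * d) - 2 * (a * c)) =
          ?D 0 + ?N * (2 * (b * d) - 2 * (a * c))] (mod 4)"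
        using D[of 0] by (intro cong_add) (simp_all add: cong_sym)
      finally have "[(\<Sum>k=1..n. ?D k) = ?D 0 + ?N * (2 * (b * d) - 2 * (a * c))] (mod 4)" .
      moreover have "[(\<Sum>k=1..n. 2 * (v False k * w False k)) =
          2 * (v False 0 * w False 0) + ?N * (2 * (a * c))] (mod 2)"
        by (simp add: cong_def sum_distrib_left[symmetric])
      ultimately show ?case using elim by (simp add: cong_mult)
    qed
  qed
qed

text \<open>
  As the even elements \<open>2 w\<close> have products \<open>2 (2 v w)\<close>, \<open>balanced\<close> is applied to the halves, which
  are determined modulo 4.
\<close>

definition Z8_witness :: "(bool \<times> nat \<Rightarrow> nat) set" where
  "Z8_witness = {x. (\<forall>i. x i \<le> 7) \<and> (\<exists>w. balanced w \<and> (\<forall>i k. [int (x (i, k)) = 2 * w i k] (mod 8)))}"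

lemma Z8_witnessI:
  assumes "balanced w" "\<And>i k. [int (x (i, k)) = 2 * w i k] (mod 8)" "\<And>i. x i \<le> 7"
  shows "x \<in> Z8_witness"
  using assms by (auto simp: Z8_witness_def)

lemma Z8_witness_zero: "(\<lambda>_. 0) \<in> Z8_witness"
proof (rule Z8_witnessI)
  show "balanced (\<lambda>i k. 0)"
    unfolding balanced_def by (intro exI[of _ 0]) simp
qed auto

lemma Z8_witness_add:
  assumes "x \<in> Z8_witness" "y \<in> Z8_witness"
  shows "(\<lambda>i. (x i + y i) mod 8) \<in> Z8_witness"
proof -
  obtain v w where v: "balanced v" "\<And>i k. [int (x (i, k)) = 2 * v i k] (mod 8)"
    and w: "balanced w" "\<And>i k. [int (y (i, k)) = 2 * w i k] (mod 8)"
    using assms by (auto simp: Z8_witness_def)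
  show ?thesis
  proof (rule Z8_witnessI[OF balanced_add[OF v(1) w(1)]])
    show "[int ((x (i, k) + y (i, k)) mod 8) = 2 * (v i k + w i k)] (mod 8)" for i k
      using cong_add[OF v(2)[of i k] w(2)[of i k]] by (simp add: cong_def zmod_int algebra_simps)
    show "(x i + y i) mod 8 \<le> 7" for i by presburger
  qed
qed

lemma Z8_witness_mult:
  assumes "x \<in> Z8_witness" "y \<in> Z8_witness"
  shows "(\<lambda>i. (x i * y i) mod 8) \<in> Z8_witness"
proof -
  obtain v w where v: "balanced v" "\<And>i k. [int (x (i, k)) = 2 * v i k] (mod 8)"
    and w: "balanced w" "\<And>i k. [int (y (i, k)) = 2 * w i k] (mod 8)"
    using assms by (auto simp: Z8_witness_def)
  show ?thesis
  proof (rule Z8_witnessI[OF balanced_mult[OF v(1) w(1)]])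
    show "[int ((x (i, k) * y (i, k)) mod 8) = 2 * (2 * (v i k * w i k))] (mod 8)" for i k
      using cong_mult[OF v(2)[of i k] w(2)[of i k]] by (simp add: cong_def zmod_int algebra_simps)
    have "n mod 8 \<le> 7" for n :: nat by presburger
    then show "(x i * y i) mod 8 \<le> 7" for i .
  qed
qed

lemma subuniverse_Z8_witness: "subuniverse ring_arity (power_algebra ring_arity Z8 UNIV) Z8_witness"
  unfolding subuniverse_def
proof (intro conjI allI ballI)
  show "Z8_witness \<noteq> {}" using Z8_witness_zero by blast
  show "Z8_witness \<subseteq> carrier (power_algebra ring_arity Z8 UNIV)"
    by (auto simp: Z8_witness_def power_algebra_def Z8_def)
  fix f x assume x: "x \<in> {..<ring_arity f} \<rightarrow>\<^sub>E Z8_witness"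
  then have xk: "x k \<in> Z8_witness" if "k < ring_arity f" for k
    using that by (blast intro: PiE_mem)
  show "interp (power_algebra ring_arity Z8 UNIV) f x \<in> Z8_witness"
  proof (cases f)
    case Plus
    then have "x 0 \<in> Z8_witness" "x 1 \<in> Z8_witness" by (simp_all add: xk)
    from Z8_witness_add[OF this] show ?thesis
      using Plus by (simp add: power_algebra_def Z8_def compose_def restrict_def)
  next
    case Times
    then have "x 0 \<in> Z8_witness" "x 1 \<in> Z8_witness" by (simp_all add: xk)
    from Z8_witness_mult[OF this] show ?thesis
      using Times by (simp add: power_algebra_def Z8_def compose_def restrict_def)
  next
    case Zero
    then show ?thesis
      using Z8_witness_zero by (simp add: power_algebra_def Z8_def restrict_def)
  qed
qed

text \<open>The halves are eventually constant modulo 4, which fixes their doubles modulo 8.\<close>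

lemma Z8_witness_eventually_constant:
  assumes "x \<in> Z8_witness"
  shows "\<exists>N. \<forall>i. \<forall>n\<ge>N. x (i, n) = x (i, N)"
proof -
  obtain w where w: "balanced w" "\<And>i k. [int (x (i, k)) = 2 * w i k] (mod 8)" and x: "\<And>i. x i \<le> 7"
    using assms by (auto simp: Z8_witness_def)
  obtain a b where "\<forall>\<^sub>F n in sequentially. [w False n = a] (mod 4) \<and> [w True n = b] (mod 4)"
    using w(1) unfolding balanced_def by (elim exE conjE) (rule that, erule eventually_mono, blast)
  then obtain N where N: "\<And>n. n \<ge> N \<Longrightarrow> [w False n = a] (mod 4) \<and> [w True n = b] (mod 4)"
    by (auto simp: eventually_sequentially)
  have "x (i, n) = nat (2 * (if i then b else a) mod 8)" if "n \<ge> N" for i n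
  proof -
    have "[w i n = (if i then b else a)] (mod 4)" using N[OF that] by (cases i) auto
    then have "[2 * w i n = 2 * (if i then b else a)] (mod 8)"
      using cong_cmult_leftI[of "w i n" _ 4 2] by simp
    then have "[int (x (i, n)) = 2 * (if i then b else a)] (mod 8)"
      using w(2)[of i n] cong_trans by blast
    moreover have "int (x (i, n)) mod 8 = int (x (i, n))" using x[of "(i, n)"] by simp
    ultimately show ?thesis by (simp add: cong_def)
  qed
  then show ?thesis by (intro exI[of _ N]) simp
qed

text \<open>For each \<open>N\<close>, a function that is constant from \<open>N\<close> on is
  determined by finitely many values in a finite set.\<close>

lemma countable_Z8_witness: "countable Z8_witness"
proof -
  define E where "E N = {x \<in> Z8_witness. \<forall>i. \<forall>n\<ge>N. x (i, n) = x (i, N)}" for N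
  have "finite (E N)" for N
  proof -
    let ?K = "UNIV \<times> {..N} :: (bool \<times> nat) set"
    have "inj_on (\<lambda>x. restrict x ?K) (E N)"
    proof (rule inj_onI, rule ext)
      fix x y and i :: "bool \<times> nat" assume xy: "x \<in> E N" "y \<in> E N" and eq: "restrict x ?K = restrict y ?K"
      obtain j n where i: "i = (j, n)" by (cases i)
      have "x (j, min n N) = y (j, min n N)"
        using fun_cong[OF eq, of "(j, min n N)"] by simp
      moreover have "z (j, n) = z (j, min n N)" if z: "z \<in> E N" for z
      proof (cases "n \<le> N")
        case False
        moreover have "\<forall>i. \<forall>n\<ge>N. z (i, n) = z (i, N)" using z unfolding E_def by blast
        ultimately have "z (j, n) = z (j, N)" using nle_le by blast
        then show ?thesis using False by (simp add: min_def)
      qed (simp add: min_def)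
      ultimately show "x i = y i" using xy i by metis
    qed
    moreover have "x i \<in> {..7}" if "x \<in> E N" for x i
      using that unfolding E_def Z8_witness_def by blast
    then have "(\<lambda>x. restrict x ?K) ` E N \<subseteq> ?K \<rightarrow>\<^sub>E {..7}"
      by (intro image_subsetI restrict_PiE_iff[THEN iffD2] ballI)
    ultimately show ?thesis
      by (rule inj_on_finite) (intro finite_PiE, simp_all)
  qed
  then have "countable (\<Union>N. E N)" by (simp add: countable_finite)
  moreover have "Z8_witness \<subseteq> (\<Union>N. E N)"
    using Z8_witness_eventually_constant unfolding E_def by blast
  ultimately show ?thesis by (rule countable_subset[rotated])
qed

section \<open>The ghost element and the generators\<close>

text \<open>The pointwise limit of the products of \<open>indicator_T\<close> and
  \<open>indicator_H j\<close> modulo 8 as \<open>j\<close> grows.\<close>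

definition ghost :: "bool \<times> nat \<Rightarrow> nat" where
  "ghost = (\<lambda>(i, k). if i \<and> k = 0 then 4 else 0)"

text \<open>A half \<open>w\<close> of the ghost is divisible by 4 except at
  \<open>(True, 0)\<close>, where it is 2 modulo 4. Hence both limits and the sum of row differences
  vanish modulo 4, and the sum condition would make \<open>w True 0\<close> divisible by 4.\<close>

lemma ghost_notin_Z8_witness: "ghost \<notin> Z8_witness"
proof
  assume "ghost \<in> Z8_witness"
  then obtain w where "balanced w" and w: "\<And>i k. [int (ghost (i, k)) = 2 * w i k] (mod 8)"
    by (auto simp: Z8_witness_def)
  have z: "4 dvd w i k" if "\<not> i \<or> k > 0" for i k
    using w[of i k] that by (auto simp: ghost_def cong_def) presburger+
  have w0: "w True 0 mod 4 = 2"
    using w[of True 0] by (simp add: ghost_def cong_def) presburger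
  obtain a b where "\<forall>\<^sub>F n in sequentially. [w False n = a] (mod 4) \<and> [w True n = b] (mod 4) \<and>
        [(\<Sum>k=1..n. w False k) = w False 0 + (int n - 1) * a] (mod 2) \<and>
        [(\<Sum>k=1..n. w True k - w False k) = w True 0 - w False 0 + (int n - 1) * (b - a)] (mod 4)"
    using \<open>balanced w\<close> unfolding balanced_def by blast
  then obtain N where N: "\<And>n. n \<ge> N \<Longrightarrow> [w False n = a] (mod 4) \<and> [w True n = b] (mod 4) \<and>
      [(\<Sum>k=1..n. w True k - w False k) = w True 0 - w False 0 + (int n - 1) * (b - a)] (mod 4)"
    unfolding eventually_sequentially by blast
  \<comment> \<open>A positive index avoids the exceptional point \<open>(True, 0)\<close>.\<close>
  define n where "n = Suc N"
  have n: "[w False n = a] (mod 4)" "[w True n = b] (mod 4)"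
      "[(\<Sum>k=1..n. w True k - w False k) = w True 0 - w False 0 + (int n - 1) * (b - a)] (mod 4)"
    using N[of n] by (auto simp: n_def)
  have "4 dvd a" "4 dvd b" using n(1,2) z[of False n] z[of True n] cong_dvd_iff by (auto simp: n_def)
  moreover have "4 dvd (\<Sum>k=1..n. w True k - w False k)"
    using z by (intro dvd_sum) (auto intro: dvd_diff)
  ultimately have "4 dvd w True 0 - w False 0 + (int n - 1) * (b - a)" "4 dvd (int n - 1) * (b - a)"
    using cong_dvd_iff[OF n(3)] by (auto intro: dvd_diff dvd_mult)
  then have "4 dvd w True 0 - w False 0" by (simp add: dvd_add_left_iff)
  then have "4 dvd w True 0" using z[of False 0] by (simp add: dvd_diff_left_iff)
  then show False using w0 by simp
qed

text \<open>This and \<open>indicator_H j\<close> are the doubled functions \<open>2 t\<close> and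
  \<open>2 (h j)\<close>; their halves have values 0 and 1.\<close>

definition indicator_T :: "bool \<times> nat \<Rightarrow> nat" where
  "indicator_T = (\<lambda>(i, k). if i then 2 else 0)"

definition indicator_H :: "nat \<Rightarrow> bool \<times> nat \<Rightarrow> nat" where
  "indicator_H j = (\<lambda>(i, k). if k = 0 \<or> k = Suc j then 2 else 0)"

lemma indicator_T_in: "indicator_T \<in> Z8_witness"
proof (rule Z8_witnessI)
  show "balanced (\<lambda>i k. if i then 1 else 0)"
    unfolding balanced_def by (rule exI[of _ 0], rule exI[of _ 1]) simp
qed (auto simp: indicator_T_def)

text \<open>Both rows of the half agree and have limit 0, and the single 1 at \<open>Suc j\<close>
  balances the 1 at 0.\<close>

lemma indicator_H_in: "indicator_H j \<in> Z8_witness"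
proof (rule Z8_witnessI)
  let ?w = "\<lambda>i k. if k = 0 \<or> k = Suc j then 1 else 0 :: int"
  have "\<forall>\<^sub>F n in sequentially. ?w False n = 0 \<and> (\<Sum>k=1..n. ?w False k) = 1"
    unfolding eventually_sequentially
  proof (intro exI[of _ "Suc (Suc j)"] allI impI)
    \<comment> \<open>From this bound on, \<open>n\<close> lies beyond the support and the sum
      includes \<open>Suc j\<close>.\<close>
    fix n assume n: "n \<ge> Suc (Suc j)"
    have "(\<Sum>k=1..n. ?w False k) = (\<Sum>k\<in>{Suc j}. ?w False k)"
      using n by (intro sum.mono_neutral_right) auto
    then show "?w False n = 0 \<and> (\<Sum>k=1..n. ?w False k) = 1" using n by simp
  qed
  then show "balanced ?w"
    unfolding balanced_def by (intro exI[of _ 0]) (auto elim!: eventually_mono)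
qed (auto simp: indicator_H_def)

section \<open>Homomorphisms into \<open>Z8\<close> and the conclusion\<close>

lemma Z8_hom_mult:
  assumes f: "f \<in> hom ring_arity (subalgebra (power_algebra ring_arity Z8 UNIV) S) Z8"
    and x: "x \<in> S" and y: "y \<in> S"
  shows "f (\<lambda>i. (x i * y i) mod 8) = (f x * f y) mod 8"
proof -
  let ?xy = "\<lambda>k\<in>{..<2 :: nat}. if k = 0 then x else y"
  have "?xy \<in> {..<2} \<rightarrow>\<^sub>E S" using x y by auto
  then show ?thesis
    using hom_app[OF f, of ?xy Times]
    by (simp add: subalgebra_def power_algebra_def Z8_def compose_def restrict_def)
qed

lemma Z8_hom_zero:
  assumes f: "f \<in> hom ring_arity (subalgebra (power_algebra ring_arity Z8 UNIV) S) Z8"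
  shows "f (\<lambda>i. 0) = 0"
  using hom_app[OF f, of "\<lambda>_. undefined" Zero]
  by (simp add: subalgebra_def power_algebra_def Z8_def compose_def restrict_def)

text \<open>Functions with values 0 and 2 have cube 0 modulo 8, and so do their images under
  homomorphisms; this makes the images even.\<close>

lemma even_of_cube_mod_8:
  fixes y :: nat
  assumes "((y * y) mod 8 * y) mod 8 = 0"
  shows "even y"
proof (rule ccontr)
  assume "odd y"
  then have "odd (y * y * y)" by simp
  moreover have "8 dvd y * y * y" using assms by (simp add: mod_mult_left_eq mod_eq_0_iff_dvd)
  ultimately show False by (meson dvd_trans even_numeral)
qed

text \<open>For the halves \<open>s\<close> and \<open>z i\<close>, products modulo 8 are 4 times a
  parity. If two of the \<open>z i\<close> are odd, then \<open>q = 4\<close>, which forces all to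
  be odd. So either all \<open>z i\<close> are odd or at most one is.\<close>

lemma constant_up_to_one:
  fixes y :: "nat \<Rightarrow> nat"
  assumes t: "even t" and y: "\<And>i. even (y i)"
    and q: "\<And>i k. i \<noteq> k \<Longrightarrow> (y i * y k) mod 8 = q"
  shows "\<exists>v. finite {i. (t * y i) mod 8 \<noteq> v} \<and> card {i. (t * y i) mod 8 \<noteq> v} \<le> 1"
proof -
  obtain s z where s: "t = 2 * s" and z: "\<And>i. y i = 2 * z i"
    using t y unfolding dvd_def by metis
  have m: "(2 * a * (2 * b)) mod 8 = 4 * ((a * b) mod 2)" for a b :: nat
    using mult_mod_right[of 4 "a * b" 2] by (simp add: ac_simps)
  have val: "(t * y i) mod 8 = (if odd (z i) then 4 * (s mod 2) else 0)" for i
    unfolding s z m by (auto simp: mod2_eq_if)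
  have zz: "odd (z i) \<and> odd (z k) \<longleftrightarrow> q = 4" if "i \<noteq> k" for i k
    using q[OF that] unfolding z m by (auto simp: mod2_eq_if split: if_splits)
  show ?thesis
  proof (cases "\<forall>i. odd (z i)")
    case True
    then show ?thesis by (simp add: val)
  next
    case False
    have "i = k" if ik: "odd (z i)" "odd (z k)" for i k
    proof (rule ccontr)
      assume "i \<noteq> k"
      then have "q = 4" using zz ik by blast
      then have "odd (z j)" for j using zz[of j "Suc j"] by simp
      then show False using False by blast
    qed
    then obtain k where "{i. odd (z i)} \<subseteq> {k}" by blast
    then have "{i. (t * y i) mod 8 \<noteq> 0} \<subseteq> {k}" by (auto simp: val)
    from finite_subset[OF this] card_mono[OF _ this] show ?thesis
      by (intro exI[of _ 0]) simp
  qed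
qed

theorem theorem4p1:
  assumes "infinite (UNIV :: 'b set)"
  shows "\<not> dualizable TYPE('b) ring_arity Z8"
proof -
  define c where "c j = (\<lambda>i. (indicator_T i * indicator_H j i) mod 8)" for j
  show ?thesis
  proof (rule ghost_element[OF assms subuniverse_Z8_witness countable_Z8_witness])
    show "c j \<in> Z8_witness" for j
      unfolding c_def by (rule Z8_witness_mult[OF indicator_T_in indicator_H_in])
    show "ghost \<in> extensional UNIV" by simp
    show "ghost \<notin> Z8_witness" by (rule ghost_notin_Z8_witness)
    show "finite {j. c j i \<noteq> ghost i}" for i
    proof -
      \<comment> \<open>Apart from its value at second coordinate 0, \<open>c j\<close> can be
        nonzero only where this coordinate is \<open>Suc j\<close>.\<close>
      have "{j. c j i \<noteq> ghost i} \<subseteq> {j. Suc j = snd i}"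
        by (auto simp: c_def ghost_def indicator_T_def indicator_H_def split: prod.splits if_splits)
      also have "\<dots> \<subseteq> {..snd i}" by auto
      finally show ?thesis by (rule finite_subset) simp
    qed
  next
    fix f assume f: "f \<in> hom ring_arity
      (subalgebra (power_algebra ring_arity Z8 UNIV) Z8_witness) Z8"
    note mult = Z8_hom_mult[OF f]
    have even: "even (f x)" if x: "x \<in> Z8_witness" and "\<And>i. x i = 0 \<or> x i = 2" for x
    proof (rule even_of_cube_mod_8)
      have "(\<lambda>i. (x i * x i) mod 8 * x i mod 8) = (\<lambda>i. 0)"
      proof
        show "(x i * x i) mod 8 * x i mod 8 = 0" for i using that(2)[of i] by auto
      qed
      then show "f x * f x mod 8 * f x mod 8 = 0"
        using mult[OF Z8_witness_mult[OF x x] x] mult[OF x x] Z8_hom_zero[OF f] by simp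
    qed
    \<comment> \<open>The common product of any two distinct \<open>indicator_H j\<close>, whose
      supports meet only at second coordinate 0.\<close>
    define p :: "bool \<times> nat \<Rightarrow> nat" where "p = (\<lambda>(i, k). if k = 0 then 4 else 0)"
    have "(f (indicator_H j) * f (indicator_H k)) mod 8 = f p" if "j \<noteq> k" for j k
    proof -
      have "(\<lambda>i. indicator_H j i * indicator_H k i mod 8) = p"
        using that by (auto simp: p_def indicator_H_def)
      then show ?thesis using mult[OF indicator_H_in indicator_H_in, of j k] by simp
    qed
    moreover have "even (f indicator_T)"
      by (rule even[OF indicator_T_in]) (auto simp: indicator_T_def)
    moreover have "even (f (indicator_H j))" for j
      by (rule even[OF indicator_H_in]) (auto simp: indicator_H_def split: if_splits)
    moreover have "f (c j) = (f indicator_T * f (indicator_H j)) mod 8" for j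
      unfolding c_def by (rule mult[OF indicator_T_in indicator_H_in])
    ultimately show "\<exists>v. finite {j. f (c j) \<noteq> v} \<and> card {j. f (c j) \<noteq> v} \<le> 1"
      using constant_up_to_one[of "f indicator_T" "\<lambda>j. f (indicator_H j)" "f p"] by simp
  qed
qed

end
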